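(* Let $G$ be a proper interval graph on $[n]=\{1,\ldots,n\}$, with its vertices labeled so that for all $i<j$, $\{i,j\}\in E(G)$ implies that the induced subgraph of $G$ on $\{i,i+1,\ldots,j\}$ is complete. Let $I_G\subset K[x_1,\ldots,x_n]$ be the vertex cover ideal of $G$. Then $I_G$ is a sortable ideal.
   Context: Graphs are finite and simple. A graph $G$ with $n$ vertices is called a proper interval graph if there exists a labeling of its vertex set by $[n]$ such that for all $i<j$, $\{i,j\}\in E(G)$ implies that the induced subgraph of $G$ on $\{i,i+1,\ldots,j\}$ is a complete graph. A subset $C\subseteq [n]$ is a vertex cover of $G$ if it intersects every edge of $G$; it is a minimal vertex cover if no proper subset of it is a vertex cover. Let $K$ be a field and $S=K[x_1,\ldots,x_n]$. The vertex cover ideal of $G$ is $I_G=(x_{C_1},\ldots,x_{C_m})\subset S$, where $C_1,\ldots,C_m$ are the minimal vertex covers of $G$ and $x_C=\prod_{i\in C}x_i$. For monomials $u,v\in S$ (of arbitrary, possibly different degrees), write $uv=x_{i_1}x_{i_2}\cdots x_{i_t}$ with $i_1\le i_2\le\cdots\le i_t$. Set $u'=x_{i_1}x_{i_3}x_{i_5}\cdots$ (product over all odd positions $\le t$) and $v'=x_{i_2}x_{i_4}x_{i_6}\cdots$ (product over all even positions $\le t$); then $\operatorname{sort}(u,v)=(u',v')$. A set $B$ of monomials is called sortable if $\operatorname{sort}(u,v)\in B\times B$ for all $(u,v)\in B\times B$. A monomial ideal $I$ is called sortable if its unique minimal set of monomial generators $\mathcal{G}(I)$ is a sortable set. *)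

theory Defs
  imports "HOL-Library.Poly_Mapping"
begin

subsection \<open>Proper interval graphs and vertex covers\<close>

text \<open>A graph on \<open>[n] = {1..n}\<close> is given by its set of edges, each a two-element set of vertices.\<close>

definition simple_graph :: "nat \<Rightarrow> nat set set \<Rightarrow> bool" where
  "simple_graph n E \<longleftrightarrow> (\<forall>e\<in>E. e \<subseteq> {1..n} \<and> card e = 2)"

definition induces_complete :: "nat set set \<Rightarrow> nat set \<Rightarrow> bool" where
  "induces_complete E W \<longleftrightarrow> (\<forall>a\<in>W. \<forall>b\<in>W. a \<noteq> b \<longrightarrow> {a, b} \<in> E)"

definition proper_interval_labeled :: "nat \<Rightarrow> nat set set \<Rightarrow> bool" where
  "proper_interval_labeled n E \<longleftrightarrow>
     (\<forall>i\<in>{1..n}. \<forall>j\<in>{1..n}. i < j \<longrightarrow> {i, j} \<in> E \<longrightarrow> induces_complete E {i..j})"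

definition vertex_cover :: "nat \<Rightarrow> nat set set \<Rightarrow> nat set \<Rightarrow> bool" where
  "vertex_cover n E C \<longleftrightarrow> C \<subseteq> {1..n} \<and> (\<forall>e\<in>E. e \<inter> C \<noteq> {})"

definition minimal_vertex_cover :: "nat \<Rightarrow> nat set set \<Rightarrow> nat set \<Rightarrow> bool" where
  "minimal_vertex_cover n E C \<longleftrightarrow>
     vertex_cover n E C \<and> (\<forall>D. D \<subset> C \<longrightarrow> \<not> vertex_cover n E D)"


subsection \<open>Monomials, polynomials and ideals\<close>

text \<open>
  A monomial is identified with its exponent vector, so the product of two monomials is the sum
  of their exponent vectors. A polynomial maps finitely many monomials to nonzero coefficients; its
  product is the convolution product on \<^typ>\<open>(nat \<Rightarrow>\<^sub>0 nat) \<Rightarrow>\<^sub>0 'k::field\<close>.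
\<close>

type_synonym monom = "nat \<Rightarrow>\<^sub>0 nat"

type_synonym 'k mpoly = "monom \<Rightarrow>\<^sub>0 'k"

definition monoms :: "nat \<Rightarrow> monom set" where
  "monoms n = {m. Poly_Mapping.keys m \<subseteq> {1..n}}"

text \<open>The ring \<open>S = K[x\<^sub>1, \<dots>, x\<^sub>n]\<close>, a subring of the polynomials in infinitely many variables.\<close>

definition poly_ring :: "nat \<Rightarrow> 'k::field mpoly set" where
  "poly_ring n = {p. Poly_Mapping.keys p \<subseteq> monoms n}"

definition monom_poly :: "monom \<Rightarrow> 'k::field mpoly" where
  "monom_poly m = Poly_Mapping.single m 1"

definition var :: "nat \<Rightarrow> 'k::field mpoly" where
  "var i = monom_poly (Poly_Mapping.single i 1)"

text \<open>The ideal of \<open>S\<close> (not of the ambient ring) generated by \<open>A\<close>.\<close>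

definition ideal_gen :: "nat \<Rightarrow> 'k::field mpoly set \<Rightarrow> 'k mpoly set" where
  "ideal_gen n A =
     {(\<Sum>f\<in>F. q f * f) | F q. finite F \<and> F \<subseteq> A \<and> (\<forall>f\<in>F. q f \<in> poly_ring n)}"

definition vertex_cover_ideal :: "nat \<Rightarrow> nat set set \<Rightarrow> 'k::field mpoly set" where
  "vertex_cover_ideal n E = ideal_gen n {(\<Prod>i\<in>C. var i) | C. minimal_vertex_cover n E C}"

definition monomial_ideal :: "nat \<Rightarrow> 'k::field mpoly set \<Rightarrow> bool" where
  "monomial_ideal n I \<longleftrightarrow> (\<exists>B \<subseteq> monoms n. I = ideal_gen n (monom_poly ` B))"

definition minimal_monomial_generators :: "nat \<Rightarrow> 'k::field mpoly set \<Rightarrow> monom set \<Rightarrow> bool" where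
  "minimal_monomial_generators n I B \<longleftrightarrow>
     B \<subseteq> monoms n \<and> I = ideal_gen n (monom_poly ` B) \<and>
     (\<forall>B'. B' \<subset> B \<longrightarrow> I \<noteq> ideal_gen n (monom_poly ` B'))"

text \<open>
  \<open>\<G>(I)\<close>. The description is proper for every monomial ideal, by
  \<open>ex1_minimal_monomial_generators\<close> below.
\<close>

definition mingens :: "nat \<Rightarrow> 'k::field mpoly set \<Rightarrow> monom set" where
  "mingens n I = (THE B. minimal_monomial_generators n I B)"


subsection \<open>Sorting\<close>

text \<open>
  \<open>monom_indices m\<close> is the weakly increasing list \<open>[i\<^sub>1, \<dots>, i\<^sub>t]\<close> with
  \<open>m = x\<^bsub>i\<^sub>1\<^esub> \<cdots> x\<^bsub>i\<^sub>t\<^esub>\<close>; see \<open>sorted_monom_indices\<close> and \<open>list_monom_monom_indices\<close>.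
\<close>

definition monom_indices :: "monom \<Rightarrow> nat list" where
  "monom_indices m =
     concat (map (\<lambda>i. replicate (Poly_Mapping.lookup m i) i)
       (sorted_list_of_set (Poly_Mapping.keys m)))"

definition list_monom :: "nat list \<Rightarrow> monom" where
  "list_monom is = (\<Sum>i\<leftarrow>is. Poly_Mapping.single i 1)"

text \<open>List positions are counted from 0, so the odd positions \<open>1, 3, 5, \<dots>\<close> are the even ones here.\<close>

definition sort_pair :: "monom \<Rightarrow> monom \<Rightarrow> monom \<times> monom" where
  "sort_pair u v =
     (list_monom (nths (monom_indices (u + v)) {k. even k}),
      list_monom (nths (monom_indices (u + v)) {k. odd k}))"

definition sortable :: "monom set \<Rightarrow> bool" where
  "sortable B \<longleftrightarrow> (\<forall>u\<in>B. \<forall>v\<in>B. sort_pair u v \<in> B \<times> B)"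

definition sortable_ideal :: "nat \<Rightarrow> 'k::field mpoly set \<Rightarrow> bool" where
  "sortable_ideal n I \<longleftrightarrow> monomial_ideal n I \<and> sortable (mingens n I)"


subsection \<open>The definitions are proper\<close>

lemma sorted_monom_indices: "sorted (monom_indices m)"
proof -
  have "sorted (concat (map (\<lambda>i. replicate (f i) i) xs))" if "sorted xs" for xs and f :: "nat \<Rightarrow> nat"
    using that by (induction xs) (auto simp: sorted_append)
  then show ?thesis by (simp add: monom_indices_def)
qed

lemma list_monom_monom_indices: "list_monom (monom_indices m) = m"
proof -
  have app: "list_monom (xs @ ys) = list_monom xs + list_monom ys" for xs ys
    by (simp add: list_monom_def)
  have rep: "list_monom (replicate k i) = Poly_Mapping.single i k" for k i
    by (induction k) (simp_all add: list_monom_def flip: single_add)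
  have con: "list_monom (concat (map (\<lambda>i. replicate (Poly_Mapping.lookup m i) i) xs)) =
      (\<Sum>i\<leftarrow>xs. Poly_Mapping.single i (Poly_Mapping.lookup m i))" for xs
    by (induction xs) (simp_all add: app rep, simp add: list_monom_def)
  have "list_monom (monom_indices m) =
      (\<Sum>i\<in>Poly_Mapping.keys m. Poly_Mapping.single i (Poly_Mapping.lookup m i))"
    unfolding monom_indices_def con by (simp add: sum_list_distinct_conv_sum_set)
  also have "\<dots> = m"
    by (rule poly_mapping_eqI)
      (simp add: lookup_sum lookup_single when_def in_keys_iff)
  finally show ?thesis .
qed

lemma poly_ring_0 [simp]: "0 \<in> poly_ring n"
  by (simp add: poly_ring_def)

lemma monoms_add: "a \<in> monoms n \<Longrightarrow> b \<in> monoms n \<Longrightarrow> a + b \<in> monoms n"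
  using keys_add[of a b] by (auto simp: monoms_def)

lemma monoms_addD: "a + b \<in> monoms n \<Longrightarrow> a \<in> monoms n"
  by (auto simp: monoms_def in_keys_iff lookup_add subset_iff)

lemma poly_ring_add: "p \<in> poly_ring n \<Longrightarrow> q \<in> poly_ring n \<Longrightarrow> p + q \<in> poly_ring n"
  using keys_add[of p q] by (auto simp: poly_ring_def)

lemma poly_ring_mult: "p \<in> poly_ring n \<Longrightarrow> q \<in> poly_ring n \<Longrightarrow> p * q \<in> poly_ring n"
  using keys_mult[of p q] monoms_add by (fastforce simp: poly_ring_def)

lemma monom_poly_in_poly_ring: "m \<in> monoms n \<Longrightarrow> monom_poly m \<in> poly_ring n"
  by (simp add: poly_ring_def monom_poly_def)

lemma monom_poly_add: "monom_poly (a + b) = monom_poly a * monom_poly b"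
  by (simp add: monom_poly_def mult_single)

lemma ideal_gen_mono: "A \<subseteq> B \<Longrightarrow> ideal_gen n A \<subseteq> ideal_gen n B"
  unfolding ideal_gen_def by blast

lemma ideal_gen_0: "0 \<in> ideal_gen n A"
  unfolding ideal_gen_def by (intro CollectI exI[of _ "{}"]) simp

lemma ideal_gen_multI: "f \<in> A \<Longrightarrow> p \<in> poly_ring n \<Longrightarrow> p * f \<in> ideal_gen n A"
  unfolding ideal_gen_def by (intro CollectI exI[of _ "{f}"] exI[of _ "\<lambda>_. p"]) simp

lemma ideal_gen_add:
  assumes "a \<in> ideal_gen n A" "b \<in> ideal_gen n A"
  shows "a + b \<in> ideal_gen n A"
proof -
  obtain F q where F: "finite F" "F \<subseteq> A" "\<forall>f\<in>F. q f \<in> poly_ring n" "a = (\<Sum>f\<in>F. q f * f)"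
    using assms(1) unfolding ideal_gen_def by blast
  obtain H r where H: "finite H" "H \<subseteq> A" "\<forall>f\<in>H. r f \<in> poly_ring n" "b = (\<Sum>f\<in>H. r f * f)"
    using assms(2) unfolding ideal_gen_def by blast
  define s where "s f = (if f \<in> F then q f else 0) + (if f \<in> H then r f else 0)" for f
  have "a = (\<Sum>f\<in>F\<union>H. (if f \<in> F then q f else 0) * f)"
    unfolding F(4) using F(1) H(1) by (intro sum.mono_neutral_cong_left) auto
  moreover have "b = (\<Sum>f\<in>F\<union>H. (if f \<in> H then r f else 0) * f)"
    unfolding H(4) using F(1) H(1) by (intro sum.mono_neutral_cong_left) auto
  ultimately have "a + b = (\<Sum>f\<in>F\<union>H. s f * f)"
    by (simp add: s_def distrib_right sum.distrib)
  moreover have "\<forall>f\<in>F\<union>H. s f \<in> poly_ring n"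
    using F(3) H(3) by (auto simp: s_def intro!: poly_ring_add)
  ultimately show ?thesis
    using F(1,2) H(1,2) unfolding ideal_gen_def
    by (intro CollectI exI[of _ "F \<union> H"] exI[of _ s]) auto
qed

lemma ideal_gen_sum: "(\<And>x. x \<in> X \<Longrightarrow> g x \<in> ideal_gen n A) \<Longrightarrow> sum g X \<in> ideal_gen n A"
  by (induction X rule: infinite_finite_induct) (auto intro: ideal_gen_0 ideal_gen_add)

lemma ideal_gen_mult:
  assumes "a \<in> ideal_gen n A" "p \<in> poly_ring n"
  shows "p * a \<in> ideal_gen n A"
proof -
  obtain F q where F: "F \<subseteq> A" "\<forall>f\<in>F. q f \<in> poly_ring n" "a = (\<Sum>f\<in>F. q f * f)"
    using assms(1) unfolding ideal_gen_def by blast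
  have "p * a = (\<Sum>f\<in>F. (p * q f) * f)"
    by (simp add: F(3) sum_distrib_left mult.assoc)
  also have "\<dots> \<in> ideal_gen n A"
    using F assms(2) by (intro ideal_gen_sum ideal_gen_multI poly_ring_mult) auto
  finally show ?thesis .
qed

lemma ideal_gen_minimal:
  assumes "A \<subseteq> ideal_gen n B"
  shows "ideal_gen n A \<subseteq> ideal_gen n B"
proof
  fix a assume "a \<in> ideal_gen n A"
  then obtain F q where F: "F \<subseteq> A" "\<forall>f\<in>F. q f \<in> poly_ring n" "a = (\<Sum>f\<in>F. q f * f)"
    unfolding ideal_gen_def by blast
  show "a \<in> ideal_gen n B"
    unfolding F(3) using F assms by (intro ideal_gen_sum ideal_gen_mult) auto
qed

lemma monom_poly_in_ideal_gen_iff: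
  assumes "m \<in> monoms n"
  shows "(monom_poly m :: 'k::field mpoly) \<in> ideal_gen n (monom_poly ` B) \<longleftrightarrow> (\<exists>b\<in>B. \<exists>c. m = c + b)"
proof
  assume "(monom_poly m :: 'k mpoly) \<in> ideal_gen n (monom_poly ` B)"
  then obtain F q where F: "F \<subseteq> monom_poly ` B" "(monom_poly m :: 'k mpoly) = (\<Sum>f\<in>F. q f * f)"
    unfolding ideal_gen_def by blast
  have "Poly_Mapping.lookup (monom_poly m :: 'k mpoly) m \<noteq> 0"
    by (simp add: monom_poly_def)
  then have "(\<Sum>f\<in>F. Poly_Mapping.lookup (q f * f) m) \<noteq> 0"
    unfolding F(2) by (simp add: lookup_sum)
  then obtain f where f: "f \<in> F" "Poly_Mapping.lookup (q f * f) m \<noteq> 0"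
    by (meson sum.neutral)
  obtain b where b: "b \<in> B" "f = monom_poly b" using f(1) F(1) by blast
  have "m \<in> Poly_Mapping.keys (q f * f)" using f(2) by (simp add: in_keys_iff)
  then obtain c d where "m = c + d" "d \<in> Poly_Mapping.keys f"
    using keys_mult[of "q f" f] by blast
  then show "\<exists>b\<in>B. \<exists>c. m = c + b"
    using b by (auto simp: monom_poly_def)
next
  assume "\<exists>b\<in>B. \<exists>c. m = c + b"
  then obtain b c where "b \<in> B" "m = c + b" by blast
  then show "(monom_poly m :: 'k mpoly) \<in> ideal_gen n (monom_poly ` B)"
    using assms by (auto simp: monom_poly_add intro!: ideal_gen_multI monom_poly_in_poly_ring
        dest: monoms_addD)
qed

lemma monom_poly_ideal_subset_iff:
  assumes "A \<subseteq> monoms n"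
  shows "(ideal_gen n (monom_poly ` A) :: 'k::field mpoly set) \<subseteq> ideal_gen n (monom_poly ` B) \<longleftrightarrow>
    (\<forall>a\<in>A. \<exists>b\<in>B. \<exists>c. a = c + b)"
proof -
  have "monom_poly ` A \<subseteq> (ideal_gen n (monom_poly ` A) :: 'k mpoly set)"
  proof (rule image_subsetI)
    fix a assume "a \<in> A"
    then have "\<exists>b\<in>A. \<exists>c. a = c + b" by (intro bexI[of _ a] exI[of _ 0]) simp_all
    moreover have "a \<in> monoms n" using \<open>a \<in> A\<close> assms by blast
    ultimately show "(monom_poly a :: 'k mpoly) \<in> ideal_gen n (monom_poly ` A)"
      by (simp only: monom_poly_in_ideal_gen_iff)
  qed
  then have "(ideal_gen n (monom_poly ` A) :: 'k mpoly set) \<subseteq> ideal_gen n (monom_poly ` B) \<longleftrightarrow>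
      monom_poly ` A \<subseteq> (ideal_gen n (monom_poly ` B) :: 'k mpoly set)"
    by (metis ideal_gen_minimal subset_trans)
  also have "\<dots> \<longleftrightarrow> (\<forall>a\<in>A. \<exists>b\<in>B. \<exists>c. a = c + b)"
    unfolding image_subset_iff using assms
    by (intro ball_cong refl monom_poly_in_ideal_gen_iff) blast
  finally show ?thesis .
qed

lemma monom_antisym:
  fixes a b c d :: monom
  assumes "a = c + b" "b = d + a"
  shows "a = b"
proof (rule poly_mapping_eqI)
  fix i
  have "Poly_Mapping.lookup a i = Poly_Mapping.lookup c i + Poly_Mapping.lookup b i"
    "Poly_Mapping.lookup b i = Poly_Mapping.lookup d i + Poly_Mapping.lookup a i"
    using assms by (metis lookup_add)+
  then show "Poly_Mapping.lookup a i = Poly_Mapping.lookup b i" by linarith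
qed

lemma minimal_monomial_generators_antichain:
  fixes I :: "'k::field mpoly set"
  assumes B: "minimal_monomial_generators n I B" and ab: "a \<in> B" "b \<in> B" "a = c + b"
  shows "a = b"
proof (rule ccontr)
  assume "a \<noteq> b"
  have sub: "B \<subseteq> monoms n" and I: "I = ideal_gen n (monom_poly ` B)"
    and min: "\<And>B'. B' \<subset> B \<Longrightarrow> I \<noteq> ideal_gen n (monom_poly ` B')"
    using B by (auto simp: minimal_monomial_generators_def)
  have "\<exists>y\<in>B - {a}. \<exists>c. x = c + y" if "x \<in> B" for x
    using that ab \<open>a \<noteq> b\<close> by (cases "x = a") (auto, metis DiffI add_0 singletonD)
  then have "I \<subseteq> ideal_gen n (monom_poly ` (B - {a}))"
    unfolding I by (simp add: monom_poly_ideal_subset_iff[OF sub])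
  moreover have "ideal_gen n (monom_poly ` (B - {a})) \<subseteq> I"
    unfolding I by (intro ideal_gen_mono) auto
  ultimately show False
    using min[of "B - {a}"] ab(1) by blast
qed

lemma minimal_monomial_generators_unique:
  fixes I :: "'k::field mpoly set"
  assumes "minimal_monomial_generators n I A" "minimal_monomial_generators n I B"
  shows "A \<subseteq> B"
proof
  fix a assume a: "a \<in> A"
  have A: "A \<subseteq> monoms n" "I = ideal_gen n (monom_poly ` A)"
    and B: "B \<subseteq> monoms n" "I = ideal_gen n (monom_poly ` B)"
    using assms by (auto simp: minimal_monomial_generators_def)
  obtain b c where b: "b \<in> B" "a = c + b"
    using a A B monom_poly_ideal_subset_iff[OF A(1), of B, where ?'k = 'k] by blast
  obtain a' d where a': "a' \<in> A" "b = d + a'"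
    using b(1) A B monom_poly_ideal_subset_iff[OF B(1), of A, where ?'k = 'k] by blast
  have "a = a'"
    using minimal_monomial_generators_antichain[OF assms(1) a a'(1)] b(2) a'(2)
    by (metis add.assoc)
  then have "a = b"
    using monom_antisym b(2) a'(2) by metis
  with b(1) show "a \<in> B" by simp
qed

lemma ex1_minimal_monomial_generators:
  fixes I :: "'k::field mpoly set"
  assumes "monomial_ideal n I"
  shows "\<exists>!B. minimal_monomial_generators n I B"
proof (rule ex_ex1I)
  obtain A where A: "A \<subseteq> monoms n" "I = ideal_gen n (monom_poly ` A)"
    using assms by (auto simp: monomial_ideal_def)
  define B where "B = {b \<in> A. \<forall>a\<in>A. \<forall>c. b = c + a \<longrightarrow> a = b}"
  define deg where "deg m = sum (Poly_Mapping.lookup m) {1..n}" for m :: monom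
  have BA: "B \<subseteq> A" by (auto simp: B_def)
  have div: "\<exists>b\<in>B. \<exists>c. a = c + b" if "a \<in> A" for a
    using that
  proof (induction "deg a" arbitrary: a rule: less_induct)
    case less
    show ?case
    proof (cases "a \<in> B")
      case True
      then show ?thesis by (metis add_0)
    next
      case False
      then obtain a' c where a': "a' \<in> A" "a = c + a'" "a' \<noteq> a"
        using less.prems by (auto simp: B_def)
      then have "c \<noteq> 0" by auto
      then obtain i where i: "Poly_Mapping.lookup c i \<noteq> 0"
        by (metis lookup_zero poly_mapping_eqI)
      have "c \<in> monoms n"
        using a' less.prems A(1) monoms_addD by blast
      then have "i \<in> {1..n}" using i by (simp add: monoms_def subset_iff in_keys_iff)
      then have "deg c > 0" using i unfolding deg_def by (intro sum_pos2[of _ i]) auto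
      moreover have "deg a = deg c + deg a'"
        by (simp add: a'(2) deg_def lookup_add sum.distrib)
      ultimately obtain b d where "b \<in> B" "a' = d + b"
        using less.hyps[of a'] a'(1) by auto
      then show ?thesis using a'(2) by (metis add.assoc)
    qed
  qed
  have I: "I = ideal_gen n (monom_poly ` B)"
  proof
    show "I \<subseteq> ideal_gen n (monom_poly ` B)"
      unfolding A(2) monom_poly_ideal_subset_iff[OF A(1)] using div by blast
    show "ideal_gen n (monom_poly ` B) \<subseteq> I"
      unfolding A(2) using BA by (intro ideal_gen_mono) auto
  qed
  have "I \<noteq> ideal_gen n (monom_poly ` B')" if B': "B' \<subset> B" for B'
  proof
    assume "I = ideal_gen n (monom_poly ` B')"
    moreover obtain b where b: "b \<in> B" "b \<notin> B'" using B' by blast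
    ultimately obtain b' c where "b' \<in> B'" "b = c + b'"
      using I A(1) BA monom_poly_ideal_subset_iff[of B n B', where ?'k = 'k] by blast
    moreover have "b' \<in> A" using \<open>b' \<in> B'\<close> B' BA by blast
    moreover have "\<forall>a\<in>A. \<forall>c. b = c + a \<longrightarrow> a = b"
      using b(1) unfolding B_def by blast
    ultimately have "b' = b" by (simp only:)
    then show False using b(2) \<open>b' \<in> B'\<close> by (simp only:)
  qed
  then show "\<exists>B. minimal_monomial_generators n I B"
    using I A(1) BA unfolding minimal_monomial_generators_def by blast
next
  show "\<And>A B. minimal_monomial_generators n I A \<Longrightarrow> minimal_monomial_generators n I B \<Longrightarrow> A = B"
    using minimal_monomial_generators_unique by (metis subset_antisym)
qed

end

theory Submission
  imports Defs
begin

text \<open>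
  Both parts of being a minimal vertex cover are bounds on the number of elements of \<open>C\<close> in
  intervals: \<open>C\<close> covers the edges iff \<open>|C \<inter> [i, j]| \<ge> j - i\<close> for every edge \<open>{i < j}\<close>, because
  \<open>[i, j]\<close> is a clique; and a vertex cover is minimal iff it contains no closed neighbourhood, where
  closed neighbourhoods are intervals \<open>[l, r]\<close>, so that the condition reads \<open>|C \<inter> [l, r]| \<le> r - l\<close>.
  Sorting distributes the elements of the multiset union that lie in an interval as evenly as
  possible, hence preserves every such bound. Squarefreeness and the range of the variables are
  preserved for the same reason, with intervals \<open>[i, i]\<close>.
\<close>

subsection \<open>Sorting and interval counts\<close>

text \<open>\<open>P\<close> is downward closed and \<open>xs\<close> is sorted, so the entries
  satisfying \<open>P\<close> form a prefix. Positions start at 0, so the even ones get the larger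
  half of that prefix.\<close>

lemma length_filter_nths_parity:
  assumes "sorted xs" and "\<And>x y. x \<le> y \<Longrightarrow> P y \<Longrightarrow> P x"
  shows "length (filter P (nths xs {k. even k})) = (length (filter P xs) + 1) div 2"
    and "length (filter P (nths xs {k. odd k})) = length (filter P xs) div 2"
proof -
  \<comment> \<open>The claims need a joint induction: a new head shifts all positions by one and
    swaps the two parity classes.\<close>
  have "length (filter P (nths xs {k. even k})) = (length (filter P xs) + 1) div 2 \<and>
      length (filter P (nths xs {k. odd k})) = length (filter P xs) div 2"
    using assms(1)
  proof (induction xs)
    case (Cons x xs)
    show ?case
    proof (cases "P x")
      case True
      with Cons show ?thesis by (simp add: nths_Cons)
    next
      case False
      then have "filter P xs = []"
        using Cons.prems assms(2) by (auto simp: filter_empty_conv)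
      with Cons False show ?thesis by (simp add: nths_Cons)
    qed
  qed simp
  then show "length (filter P (nths xs {k. even k})) = (length (filter P xs) + 1) div 2"
    and "length (filter P (nths xs {k. odd k})) = length (filter P xs) div 2"
    by simp_all
qed

text \<open>Reduces interval counts to counts of prefixes, to which the parity lemma applies; the
  additive form avoids truncated subtraction.\<close>

lemma length_filter_interval:
  fixes l r :: nat
  assumes "l \<le> r"
  shows "length (filter (\<lambda>x. x < l) xs) + length (filter (\<lambda>x. x \<in> {l..r}) xs) =
    length (filter (\<lambda>x. x \<le> r) xs)"
  using assms by (induction xs) auto

lemma sum_lookup_list_monom:
  "finite A \<Longrightarrow> sum (Poly_Mapping.lookup (list_monom xs)) A = length (filter (\<lambda>x. x \<in> A) xs)"
  by (induction xs)
    (auto simp: list_monom_def lookup_add sum.distrib lookup_single when_def)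

text \<open>An interval count is a difference of two prefix counts. Sorting halves both with the
  same rounding, so the difference is within one half of the exact half.\<close>

lemma sum_lookup_sort_pair:
  assumes "l \<le> r" and "w = fst (sort_pair u v) \<or> w = snd (sort_pair u v)"
  shows "sum (Poly_Mapping.lookup (u + v)) {l..r} div 2 \<le> sum (Poly_Mapping.lookup w) {l..r}"
    and "sum (Poly_Mapping.lookup w) {l..r} \<le> (sum (Poly_Mapping.lookup (u + v)) {l..r} + 1) div 2"
proof -
  define xs where "xs = monom_indices (u + v)"
  have xs: "sorted xs" "u + v = list_monom xs"
    by (simp_all add: xs_def sorted_monom_indices list_monom_monom_indices)
  have below: "x \<le> y \<Longrightarrow> y < l \<Longrightarrow> x < l" "x \<le> y \<Longrightarrow> y \<le> r \<Longrightarrow> x \<le> r" for x y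
    by auto
  note parity = length_filter_nths_parity[OF xs(1), of "\<lambda>x. x < l", OF below(1)]
    length_filter_nths_parity[OF xs(1), of "\<lambda>x. x \<le> r", OF below(2)]
  note counts = length_filter_interval[OF assms(1), of xs]
    length_filter_interval[OF assms(1), of "nths xs {k. even k}"]
    length_filter_interval[OF assms(1), of "nths xs {k. odd k}"]
  have w: "w = list_monom (nths xs {k. even k}) \<or> w = list_monom (nths xs {k. odd k})"
    using assms(2) by (simp add: sort_pair_def xs_def)
  show "sum (Poly_Mapping.lookup (u + v)) {l..r} div 2 \<le> sum (Poly_Mapping.lookup w) {l..r}"
    and "sum (Poly_Mapping.lookup w) {l..r} \<le> (sum (Poly_Mapping.lookup (u + v)) {l..r} + 1) div 2"
    using w parity counts unfolding xs(2)
    by (auto simp only: sum_lookup_list_monom finite_atLeastAtMost)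
qed

text \<open>If both counts are at most \<open>k\<close>, the total is at most \<open>2 * k\<close>
  and even its half rounded up is at most \<open>k\<close>; dually, rounding down keeps lower
  bounds.\<close>

lemma sum_lookup_sort_pair_bounds:
  assumes "w = fst (sort_pair u v) \<or> w = snd (sort_pair u v)" and "l \<le> r"
  shows "sum (Poly_Mapping.lookup u) {l..r} \<le> k \<Longrightarrow> sum (Poly_Mapping.lookup v) {l..r} \<le> k \<Longrightarrow>
      sum (Poly_Mapping.lookup w) {l..r} \<le> k"
    and "k \<le> sum (Poly_Mapping.lookup u) {l..r} \<Longrightarrow> k \<le> sum (Poly_Mapping.lookup v) {l..r} \<Longrightarrow>
      k \<le> sum (Poly_Mapping.lookup w) {l..r}"
  using sum_lookup_sort_pair[OF assms(2,1)] by (simp_all add: lookup_add sum.distrib)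


subsection \<open>Minimal vertex covers of proper interval graphs\<close>

definition closed_nbhd :: "nat \<Rightarrow> nat set set \<Rightarrow> nat \<Rightarrow> nat set" where
  "closed_nbhd n E v = {w \<in> {1..n}. w = v \<or> {v, w} \<in> E}"

lemma simple_graph_edgeE:
  assumes "simple_graph n E" "e \<in> E"
  obtains i j where "e = {i, j}" "i < j" "i \<in> {1..n}" "j \<in> {1..n}"
proof -
  have "e \<subseteq> {1..n}" "card e = 2" using assms by (auto simp: simple_graph_def)
  then obtain x y where xy: "e = {x, y}" "x \<noteq> y" by (meson card_2_iff)
  then show thesis
    using that[of x y] that[of y x] \<open>e \<subseteq> {1..n}\<close> by (cases "x < y") (auto simp: insert_commute)
qed

lemma proper_interval_labeledD:
  assumes "proper_interval_labeled n E" "{i, j} \<in> E" "i \<in> {1..n}" "j \<in> {1..n}" "i < j"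
    and "a \<in> {i..j}" "b \<in> {i..j}" "a \<noteq> b"
  shows "{a, b} \<in> E"
  using assms(1)[unfolded proper_interval_labeled_def induces_complete_def, rule_format,
      OF assms(3,4,5,2,6,7,8)] .

text \<open>An edge from \<open>v\<close> to its extreme neighbour on either side makes
  \<open>v\<close> adjacent to everything in between, so the ends are the minimum and
  maximum.\<close>

lemma closed_nbhd_interval:
  assumes "proper_interval_labeled n E" "v \<in> {1..n}"
  obtains l r where "l \<le> r" "closed_nbhd n E v = {l..r}"
proof -
  let ?N = "closed_nbhd n E v"
  have fin: "finite ?N" and v: "v \<in> ?N"
    using assms(2) by (auto simp: closed_nbhd_def)
  have "w \<in> ?N" if "Min ?N \<le> w" "w \<le> Max ?N" for w
  proof -
    have N: "Min ?N \<in> ?N" "Max ?N \<in> ?N" using fin v by (metis Min_in emptyE, metis Max_in emptyE)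
    then have w: "w \<in> {1..n}" using that by (auto simp: closed_nbhd_def)
    consider "w = v" | "w < v" | "v < w" by linarith
    then have "w = v \<or> {v, w} \<in> E"
    proof cases
      case 2
      \<comment> \<open>\<open>Min ?N\<close> lies strictly below \<open>v\<close>, so its
        membership in \<open>?N\<close> can only come from an edge.\<close>
      then have "{Min ?N, v} \<in> E" using N(1) that by (auto simp: closed_nbhd_def insert_commute)
      then show ?thesis
        using proper_interval_labeledD[OF assms(1), of "Min ?N" v v w] N assms(2) that 2
        by (auto simp: closed_nbhd_def)
    next
      case 3
      then have "{v, Max ?N} \<in> E" using N(2) that by (auto simp: closed_nbhd_def)
      then show ?thesis
        using proper_interval_labeledD[OF assms(1), of v "Max ?N" v w] N assms(2) that 3
        by (auto simp: closed_nbhd_def)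
    qed simp
    with w show ?thesis by (simp add: closed_nbhd_def)
  qed
  then have "{Min ?N..Max ?N} \<subseteq> ?N" by (meson atLeastAtMost_iff subsetI)
  moreover have "?N \<subseteq> {Min ?N..Max ?N}"
    by (meson Max_ge Min_le atLeastAtMost_iff fin subsetI)
  ultimately have "?N = {Min ?N..Max ?N}" by (rule subset_antisym[rotated])
  moreover have "Min ?N \<le> Max ?N" using fin v by (meson Max_ge Min_le order_trans)
  ultimately show thesis using that by blast
qed

lemma minimal_vertex_cover_iff_closed_nbhd:
  assumes "simple_graph n E"
  shows "minimal_vertex_cover n E C \<longleftrightarrow>
    vertex_cover n E C \<and> (\<forall>v\<in>{1..n}. \<not> closed_nbhd n E v \<subseteq> C)"
proof (intro iffI conjI ballI notI)
  assume C: "minimal_vertex_cover n E C"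
  then show cov: "vertex_cover n E C" by (simp add: minimal_vertex_cover_def)
  fix v assume v: "v \<in> {1..n}" and sub: "closed_nbhd n E v \<subseteq> C"
  have "e \<inter> (C - {v}) \<noteq> {}" if eE: "e \<in> E" for e
  proof -
    obtain i j where e: "e = {i, j}" "i < j" "i \<in> {1..n}" "j \<in> {1..n}"
      using simple_graph_edgeE[OF assms eE] .
    show ?thesis
    proof (cases "v \<in> e")
      case True
      then obtain w where "e = {v, w}" "w \<noteq> v" "w \<in> {1..n}"
        using e by (metis insertE insert_commute less_irrefl singletonD)
      then show ?thesis using that sub by (auto simp: closed_nbhd_def)
    next
      case False
      then show ?thesis using cov that by (auto simp: vertex_cover_def)
    qed
  qed
  then have "vertex_cover n E (C - {v})" using cov by (auto simp: vertex_cover_def)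
  moreover have "v \<in> C" using v sub by (auto simp: closed_nbhd_def)
  ultimately show False using C by (auto simp: minimal_vertex_cover_def)
next
  assume C: "vertex_cover n E C \<and> (\<forall>v\<in>{1..n}. \<not> closed_nbhd n E v \<subseteq> C)"
  have "\<not> vertex_cover n E D" if DC: "D \<subset> C" for D
  proof
    assume D: "vertex_cover n E D"
    obtain v where v: "v \<in> C" "v \<notin> D" using DC by blast
    have "v \<in> {1..n}" using C v(1) by (auto simp: vertex_cover_def)
    \<comment> \<open>As \<open>v\<close> is in \<open>C\<close> and \<open>w\<close> is not, they
      differ; so they span an edge that \<open>D\<close> misses.\<close>
    then obtain w where "w \<in> closed_nbhd n E v" "w \<notin> C"
      using C by blast
    then have "{v, w} \<in> E" "w \<notin> D" using v DC by (auto simp: closed_nbhd_def)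
    then show False using D v by (auto simp: vertex_cover_def)
  qed
  with C show "minimal_vertex_cover n E C" by (simp add: minimal_vertex_cover_def)
qed

lemma card_interval_Int_le_iff:
  fixes l r :: nat
  assumes "l \<le> r"
  shows "card (C \<inter> {l..r}) \<le> r - l \<longleftrightarrow> \<not> {l..r} \<subseteq> C"
proof
  assume "card (C \<inter> {l..r}) \<le> r - l"
  then show "\<not> {l..r} \<subseteq> C" using assms by (auto simp: Int_absorb1)
next
  assume "\<not> {l..r} \<subseteq> C"
  then have "C \<inter> {l..r} \<subset> {l..r}" by blast
  then have "card (C \<inter> {l..r}) < card {l..r}" by (intro psubset_card_mono) auto
  then show "card (C \<inter> {l..r}) \<le> r - l" using assms by simp
qed

text \<open>The interval has \<open>j - i + 1\<close> points, so the bound allows at most one point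
  outside \<open>C\<close>, which is what covering a complete graph means.\<close>

lemma card_interval_Int_ge_iff:
  fixes i j :: nat
  assumes "i < j"
  shows "j - i \<le> card (C \<inter> {i..j}) \<longleftrightarrow> (\<forall>a\<in>{i..j}. \<forall>b\<in>{i..j}. a \<noteq> b \<longrightarrow> a \<in> C \<or> b \<in> C)"
proof -
  have "card ({i..j} - C) + card (C \<inter> {i..j}) = card {i..j}"
    by (metis Int_commute add.commute card_Int_Diff finite_atLeastAtMost)
  then have "j - i \<le> card (C \<inter> {i..j}) \<longleftrightarrow> card ({i..j} - C) \<le> Suc 0"
    using assms by (auto simp: le_diff_conv)
  then show ?thesis by (auto simp: card_le_Suc0_iff_eq)
qed

text \<open>Each edge \<open>{i, j}\<close> makes \<open>{i..j}\<close> a clique, of which a cover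
  omits at most one vertex. Conversely, the bound applied to the two ends covers the edge
  itself.\<close>

lemma vertex_cover_iff_card:
  assumes "simple_graph n E" "proper_interval_labeled n E"
  shows "vertex_cover n E C \<longleftrightarrow>
    C \<subseteq> {1..n} \<and> (\<forall>i j. i < j \<longrightarrow> {i, j} \<in> E \<longrightarrow> j - i \<le> card (C \<inter> {i..j}))"
proof (intro iffI conjI allI impI)
  assume C: "vertex_cover n E C"
  then show "C \<subseteq> {1..n}" by (simp add: vertex_cover_def)
  fix i j assume ij: "i < j" "{i, j} \<in> E"
  have "i \<in> {1..n}" "j \<in> {1..n}" using assms(1) ij(2) by (auto simp: simple_graph_def)
  then have "a \<in> C \<or> b \<in> C" if "a \<in> {i..j}" "b \<in> {i..j}" "a \<noteq> b" for a b
  proof -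
    have "{a, b} \<in> E"
      by (rule proper_interval_labeledD[OF assms(2) ij(2) _ _ ij(1) that]) fact+
    then have "{a, b} \<inter> C \<noteq> {}" using C unfolding vertex_cover_def by blast
    then show ?thesis by blast
  qed
  then show "j - i \<le> card (C \<inter> {i..j})"
    by (simp add: card_interval_Int_ge_iff[OF ij(1)])
next
  assume C: "C \<subseteq> {1..n} \<and> (\<forall>i j. i < j \<longrightarrow> {i, j} \<in> E \<longrightarrow> j - i \<le> card (C \<inter> {i..j}))"
  have "e \<inter> C \<noteq> {}" if eE: "e \<in> E" for e
  proof -
    obtain i j where e: "e = {i, j}" "i < j"
      using simple_graph_edgeE[OF assms(1) eE] .
    then have "j - i \<le> card (C \<inter> {i..j})" using C that by blast
    then have "i \<in> C \<or> j \<in> C" using e(2) by (auto simp: card_interval_Int_ge_iff)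
    then show ?thesis using e(1) by blast
  qed
  with C show "vertex_cover n E C" by (simp add: vertex_cover_def)
qed

text \<open>Apart from the range of \<open>C\<close>, this leaves only bounds on interval counts
  whose constants depend on the graph alone, the form that sorting preserves.\<close>

lemma minimal_vertex_cover_iff_card:
  assumes "simple_graph n E" "proper_interval_labeled n E"
  shows "minimal_vertex_cover n E C \<longleftrightarrow> C \<subseteq> {1..n} \<and>
    (\<forall>i j. i < j \<longrightarrow> {i, j} \<in> E \<longrightarrow> j - i \<le> card (C \<inter> {i..j})) \<and>
    (\<forall>v l r. v \<in> {1..n} \<longrightarrow> l \<le> r \<longrightarrow> closed_nbhd n E v = {l..r} \<longrightarrow> card (C \<inter> {l..r}) \<le> r - l)"
proof -
  have "(\<forall>v\<in>{1..n}. \<not> closed_nbhd n E v \<subseteq> C) \<longleftrightarrow>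
    (\<forall>v l r. v \<in> {1..n} \<longrightarrow> l \<le> r \<longrightarrow> closed_nbhd n E v = {l..r} \<longrightarrow> card (C \<inter> {l..r}) \<le> r - l)"
    \<comment> \<open>Every closed neighbourhood is some \<open>{l..r}\<close>, so quantifying over
      such \<open>l\<close> and \<open>r\<close> misses no vertex.\<close>
    by (metis card_interval_Int_le_iff closed_nbhd_interval[OF assms(2)])
  then show ?thesis
    unfolding minimal_vertex_cover_iff_closed_nbhd[OF assms(1)] vertex_cover_iff_card[OF assms]
    by blast
qed


subsection \<open>The minimal monomial generators of the vertex cover ideal\<close>

text \<open>The exponent vector of \<open>x_C\<close>; for infinite \<open>C\<close> the sum
  defaults to 0.\<close>

definition set_monom :: "nat set \<Rightarrow> monom" where
  "set_monom C = (\<Sum>i\<in>C. Poly_Mapping.single i 1)"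

lemma lookup_set_monom:
  "finite C \<Longrightarrow> Poly_Mapping.lookup (set_monom C) i = (if i \<in> C then 1 else 0)"
  by (simp add: set_monom_def lookup_sum lookup_single when_def)

lemma keys_set_monom: "finite C \<Longrightarrow> Poly_Mapping.keys (set_monom C) = C"
  by (auto simp: in_keys_iff lookup_set_monom split: if_splits)

lemma sum_lookup_set_monom:
  "finite C \<Longrightarrow> finite A \<Longrightarrow> sum (Poly_Mapping.lookup (set_monom C)) A = card (C \<inter> A)"
  by (simp add: lookup_set_monom Int_commute flip: sum.inter_restrict)

text \<open>A squarefree monomial is determined by its support; this turns the output of sorting
  back into a vertex set.\<close>

lemma set_monom_keys:
  assumes "\<And>i. Poly_Mapping.lookup m i \<le> 1"
  shows "set_monom (Poly_Mapping.keys m) = m"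
proof (rule poly_mapping_eqI)
  fix i
  show "Poly_Mapping.lookup (set_monom (Poly_Mapping.keys m)) i = Poly_Mapping.lookup m i"
    using assms[of i] by (auto simp: lookup_set_monom in_keys_iff)
qed

text \<open>Finiteness of \<open>C\<close> is not assumed: for infinite \<open>C\<close> both sides
  are 1.\<close>

lemma prod_var: "(\<Prod>i\<in>C. var i :: 'k::field mpoly) = monom_poly (set_monom C)"
  by (induction C rule: infinite_finite_induct)
    (simp_all add: set_monom_def monom_poly_add var_def, simp_all add: monom_poly_def)

lemma finite_minimal_vertex_cover: "minimal_vertex_cover n E C \<Longrightarrow> finite C"
  unfolding minimal_vertex_cover_def vertex_cover_def by (meson finite_atLeastAtMost finite_subset)

text \<open>Divisibility between the monomials \<open>x_C\<close> is inclusion of the sets. Minimal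
  covers form an antichain, so no generator is a multiple of another and none can be
  omitted.\<close>

lemma minimal_monomial_generators_vertex_cover_ideal:
  "minimal_monomial_generators n (vertex_cover_ideal n E :: 'k::field mpoly set)
    (set_monom ` {C. minimal_vertex_cover n E C})"
proof -
  let ?B = "set_monom ` {C. minimal_vertex_cover n E C}"
  let ?I = "vertex_cover_ideal n E :: 'k mpoly set"
  have B: "?B \<subseteq> monoms n"
  proof (rule image_subsetI)
    fix C assume "C \<in> {C. minimal_vertex_cover n E C}"
    then have "finite C" "C \<subseteq> {1..n}"
      by (simp_all add: finite_minimal_vertex_cover)
        (simp add: minimal_vertex_cover_def vertex_cover_def)
    then show "set_monom C \<in> monoms n" by (simp add: monoms_def keys_set_monom)
  qed
  have "{(\<Prod>i\<in>C. var i :: 'k mpoly) | C. minimal_vertex_cover n E C} = monom_poly ` ?B"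
    by (auto simp: prod_var)
  then have I: "?I = ideal_gen n (monom_poly ` ?B)"
    by (simp add: vertex_cover_ideal_def)
  have "?I \<noteq> ideal_gen n (monom_poly ` B')" if B': "B' \<subset> ?B" for B'
  proof
    assume eq: "?I = ideal_gen n (monom_poly ` B')"
    obtain C where C: "minimal_vertex_cover n E C" "set_monom C \<notin> B'" using B' by blast
    then obtain b c where b: "b \<in> B'" "set_monom C = c + b"
      using eq I monom_poly_ideal_subset_iff[OF B, of B', where ?'k = 'k] by blast
    then obtain D where D: "minimal_vertex_cover n E D" "b = set_monom D" using B' by blast
    have "D \<subseteq> C"
    proof
      fix i assume "i \<in> D"
      then have "i \<in> Poly_Mapping.keys (c + b)"
        using D by (simp add: in_keys_iff lookup_add lookup_set_monom finite_minimal_vertex_cover)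
      then show "i \<in> C" using b(2) C(1) by (metis keys_set_monom finite_minimal_vertex_cover)
    qed
    then have "D = C" using C(1) D(1) by (auto simp: minimal_vertex_cover_def)
    then show False using C(2) D(2) b(1) by blast
  qed
  with B I show ?thesis by (simp add: minimal_monomial_generators_def)
qed

lemma monomial_ideal_vertex_cover_ideal:
  "monomial_ideal n (vertex_cover_ideal n E :: 'k::field mpoly set)"
  using minimal_monomial_generators_vertex_cover_ideal[of n E, where ?'k = 'k]
  unfolding monomial_ideal_def minimal_monomial_generators_def by blast

lemma mingens_vertex_cover_ideal:
  "mingens n (vertex_cover_ideal n E :: 'k::field mpoly set) =
    set_monom ` {C. minimal_vertex_cover n E C}"
  unfolding mingens_def
  by (intro the1_equality ex1_minimal_monomial_generators monomial_ideal_vertex_cover_ideal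
      minimal_monomial_generators_vertex_cover_ideal)


subsection \<open>Sortability\<close>

lemma sort_pair_minimal_vertex_cover:
  assumes G: "simple_graph n E" "proper_interval_labeled n E"
    and C: "minimal_vertex_cover n E C" and D: "minimal_vertex_cover n E D"
    and w: "w = fst (sort_pair (set_monom C) (set_monom D)) \<or>
      w = snd (sort_pair (set_monom C) (set_monom D))"
  shows "w \<in> set_monom ` {C. minimal_vertex_cover n E C}"
proof -
  note fin = finite_minimal_vertex_cover[OF C] finite_minimal_vertex_cover[OF D]
  note bounds = sum_lookup_sort_pair_bounds[OF w]
  note C' = C[unfolded minimal_vertex_cover_iff_card[OF G]]
  note D' = D[unfolded minimal_vertex_cover_iff_card[OF G]]
  \<comment> \<open>The upper bound 1 on the one-point interval \<open>{i..i}\<close> holds for both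
    inputs, so \<open>w\<close> is squarefree.\<close>
  have "Poly_Mapping.lookup w i \<le> 1" for i
    using bounds(1)[of i i 1] by (simp add: lookup_set_monom fin)
  then have W: "set_monom (Poly_Mapping.keys w) = w" by (rule set_monom_keys)
  let ?W = "Poly_Mapping.keys w"
  \<comment> \<open>Since \<open>w\<close> is the monomial of its support, the bounds on exponent
    sums become bounds on cardinalities.\<close>
  have up: "card (?W \<inter> {l..r}) \<le> k"
    if "l \<le> r" "card (C \<inter> {l..r}) \<le> k" "card (D \<inter> {l..r}) \<le> k" for l r k
    using bounds(1)[OF that(1), of k] that(2,3) sum_lookup_set_monom[of ?W "{l..r}"]
    by (simp add: sum_lookup_set_monom fin W)
  have low: "k \<le> card (?W \<inter> {l..r})"
    if "l \<le> r" "k \<le> card (C \<inter> {l..r})" "k \<le> card (D \<inter> {l..r})" for l r k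
    using bounds(2)[OF that(1), of k] that(2,3) sum_lookup_set_monom[of ?W "{l..r}"]
    by (simp add: sum_lookup_set_monom fin W)
  have "?W \<subseteq> {1..n}"
  proof
    fix i assume i: "i \<in> ?W"
    show "i \<in> {1..n}"
    proof (rule ccontr)
      assume "i \<notin> {1..n}"
      then have "i \<notin> C" "i \<notin> D" using conjunct1[OF C'] conjunct1[OF D'] by (meson subsetD)+
      \<comment> \<open>The upper bound 0 on \<open>{i..i}\<close> holds for \<open>C\<close> and
        \<open>D\<close>, hence for the support of \<open>w\<close>.\<close>
      then show False using up[of i i 0] i by simp
    qed
  qed
  then have "minimal_vertex_cover n E ?W"
    unfolding minimal_vertex_cover_iff_card[OF G] using C' D' up low by simp
  then show ?thesis using W by (metis imageI mem_Collect_eq)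
qed

theorem theorem2p1:
  fixes n :: nat and E :: "nat set set"
  assumes "simple_graph n E"
    and "proper_interval_labeled n E"
  shows "sortable_ideal n (vertex_cover_ideal n E :: 'k::field mpoly set)"
proof -
  have "sort_pair (set_monom C) (set_monom D) \<in>
      set_monom ` {C. minimal_vertex_cover n E C} \<times> set_monom ` {C. minimal_vertex_cover n E C}"
    if "minimal_vertex_cover n E C" "minimal_vertex_cover n E D" for C D
    unfolding mem_Times_iff using sort_pair_minimal_vertex_cover[OF assms that] by blast
  then show ?thesis
    by (auto simp: sortable_ideal_def sortable_def monomial_ideal_vertex_cover_ideal
        mingens_vertex_cover_ideal)
qed

end
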